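(* Let $\lambda$ be a nonzero real number. For all integers $m,n\ge 0$, $$F_{n+m,\lambda}(t)=\sum_{k=0}^{m}\sum_{l=0}^{n}k!\,{m \brace k}_{\lambda}\binom{n}{l}t^{k}\,F_{n-l,\lambda}^{(k)}(t,k-m\lambda)\,F_{l,\lambda}(t).$$
   Context: For nonzero real $\lambda$, the degenerate falling factorial is $(x)_{0,\lambda}=1$, $(x)_{n,\lambda}=x(x-\lambda)\cdots(x-(n-1)\lambda)$ for $n\ge1$, and the degenerate exponential is $e_{\lambda}^{x}(s)=(1+\lambda s)^{x/\lambda}=\sum_{k\ge0}(x)_{k,\lambda}\frac{s^k}{k!}$, with $e_\lambda(s)=e_\lambda^1(s)$. The degenerate Stirling numbers of the second kind ${n \brace k}_{\lambda}$ are defined by $\frac{1}{k!}(e_{\lambda}(s)-1)^{k}=\sum_{n\ge k}{n \brace k}_{\lambda}\frac{s^{n}}{n!}$ for $k\ge0$. The degenerate Fubini polynomials are $F_{n,\lambda}(x)=\sum_{k=0}^{n}k!{n \brace k}_{\lambda}x^{k}$, equivalently $\frac{1}{1-x(e_{\lambda}(s)-1)}=\sum_{n\ge0}F_{n,\lambda}(x)\frac{s^n}{n!}$. The two-variable degenerate Fubini polynomials of order $\alpha$ are defined by $\Big(\frac{1}{1-x(e_{\lambda}(s)-1)}\Big)^{\alpha}e_{\lambda}^{y}(s)=\sum_{n\ge0}F_{n,\lambda}^{(\alpha)}(x,y)\frac{s^{n}}{n!}$. *)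

theory Defs
  imports "HOL-Computational_Algebra.Formal_Power_Series"
begin

definition deg_ff :: "real \<Rightarrow> real \<Rightarrow> nat \<Rightarrow> real" where
  "deg_ff lam x n = (\<Prod>i<n. x - real i * lam)"

text \<open>Degenerate exponential \<open>e\<^sub>\<lambda>\<^sup>x(s) = (1 + \<lambda>s)\<^bsup>x/\<lambda>\<^esup>\<close>, with \<open>\<lambda>\<close> written \<open>lam\<close>, as a formal power series in \<open>s\<close>;
  \<open>deg_exp_eq_binomial\<close> below gives the closed form.\<close>

definition deg_exp :: "real \<Rightarrow> real \<Rightarrow> real fps" where
  "deg_exp lam x = Abs_fps (\<lambda>k. deg_ff lam x k / fact k)"

definition deg_Stirling2 :: "real \<Rightarrow> nat \<Rightarrow> nat \<Rightarrow> real" where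
  "deg_Stirling2 lam n k = fact n * fps_nth (fps_const (1 / fact k) * (deg_exp lam 1 - 1) ^ k) n"

definition deg_Fubini :: "real \<Rightarrow> nat \<Rightarrow> real \<Rightarrow> real" where
  "deg_Fubini lam n x = (\<Sum>k=0..n. fact k * deg_Stirling2 lam n k * x ^ k)"

definition deg_Fubini_gf :: "real \<Rightarrow> real \<Rightarrow> real fps" where
  "deg_Fubini_gf lam x = inverse (1 - fps_const x * (deg_exp lam 1 - 1))"

text \<open>Real powers of a power series with constant term 1: \<open>f\<^sup>\<alpha> = (1 + (f - 1))\<^sup>\<alpha>\<close> is the binomial
  series of exponent \<open>\<alpha>\<close> evaluated at \<open>f - 1\<close>; \<open>fps_rpow_of_nat\<close> below shows
  that it agrees with the ordinary power for natural exponents.\<close>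

definition fps_rpow :: "real fps \<Rightarrow> real \<Rightarrow> real fps" where
  "fps_rpow f \<alpha> = fps_binomial \<alpha> oo (f - 1)"

definition deg_Fubini2 :: "real \<Rightarrow> real \<Rightarrow> nat \<Rightarrow> real \<Rightarrow> real \<Rightarrow> real" where
  "deg_Fubini2 lam \<alpha> n x y = fact n * fps_nth (fps_rpow (deg_Fubini_gf lam x) \<alpha> * deg_exp lam y) n"

lemma deg_exp_nth_0 [simp]: "fps_nth (deg_exp lam x) 0 = 1"
  by (simp add: deg_exp_def deg_ff_def)

lemma deg_Fubini_gf_nth_0 [simp]: "fps_nth (deg_Fubini_gf lam x) 0 = 1"
  by (simp add: deg_Fubini_gf_def)

lemma deg_exp_eq_binomial:
  assumes "lam \<noteq> 0"
  shows "deg_exp lam x = fps_binomial (x / lam) oo (fps_const lam * fps_X)"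
proof -
  have "deg_ff lam x k = lam ^ k * (\<Prod>i=0..<k. x / lam - real i)" for k
  proof -
    have "deg_ff lam x k = (\<Prod>i<k. lam * (x / lam - real i))"
      unfolding deg_ff_def using assms by (intro prod.cong) (auto simp: field_simps)
    then show ?thesis
      by (simp add: prod.distrib atLeast0LessThan)
  qed
  then show ?thesis
    by (simp add: fps_eq_iff deg_exp_def fps_compose_linear gbinomial_prod_rev)
qed

lemma fps_rpow_of_nat:
  assumes "fps_nth f 0 = 1"
  shows "fps_rpow f (real k) = f ^ k"
proof -
  have "fps_rpow f (real k) = ((1 + fps_X) ^ k) oo (f - 1)"
    by (simp add: fps_rpow_def fps_binomial_of_nat)
  also have "\<dots> = ((1 + fps_X) oo (f - 1)) ^ k"
    using assms by (simp add: fps_compose_power)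
  also have "(1 + fps_X) oo (f - 1) = f"
    using assms by (simp add: fps_compose_add_distrib)
  finally show ?thesis .
qed

lemma deg_Fubini_gf_nth: "fps_nth (deg_Fubini_gf lam x) n = deg_Fubini lam n x / fact n"
proof -
  define u where "u = fps_const x * (deg_exp lam 1 - 1)"
  have u0: "fps_nth u 0 = 0"
    by (simp add: u_def)
  have "deg_Fubini_gf lam x = inverse (1 - fps_X) oo u"
    using u0 by (simp add: deg_Fubini_gf_def u_def fps_inverse_compose fps_compose_sub_distrib)
  also have "inverse (1 - fps_X) = (Abs_fps (\<lambda>_. 1) :: real fps)"
    using fps_inverse_gp' by (metis fps_inverse_idempotent fps_nth_Abs_fps zero_neq_one)
  finally have "fps_nth (deg_Fubini_gf lam x) n = (\<Sum>k=0..n. fps_nth (u ^ k) n)"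
    by (simp add: fps_compose_nth)
  also have "\<dots> = deg_Fubini lam n x / fact n"
    by (simp add: deg_Fubini_def deg_Stirling2_def u_def power_mult_distrib sum_divide_distrib
        fps_const_power mult_ac)
  finally show ?thesis .
qed

end

theory Submission
  imports Defs
begin

text \<open>With \<open>G = 1 / (1 - t (e\<^sub>\<lambda> - 1))\<close>, both sides are \<open>n!\<close> times the coefficient of \<open>s\<^sup>n\<close> in the
  \<open>m\<close>-th derivative of \<open>G\<close>. Since \<open>G' = t e\<^sub>\<lambda>\<^bsup>1-\<lambda>\<^esup> G\<^sup>2\<close>, this derivative is a combination of the
  series \<open>t\<^sup>k G\<^bsup>k+1\<^esup> e\<^sub>\<lambda>\<^bsup>k-m\<lambda>\<^esup>\<close>; its coefficients satisfy the recurrence in \<open>m\<close> of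
  \<open>k!\<close> times the degenerate Stirling numbers, which follows from \<open>(1 + \<lambda>s) e\<^sub>\<lambda>\<^bsup>1-\<lambda>\<^esup> = e\<^sub>\<lambda>\<close>.\<close>

lemma deg_exp_add:
  assumes "lam \<noteq> 0"
  shows "deg_exp lam (x + y) = deg_exp lam x * deg_exp lam y"
  using assms
  by (simp add: deg_exp_eq_binomial add_divide_distrib fps_binomial_add_mult
      fps_compose_mult_distrib)

text \<open>The factor of index 1 in the falling factorial is \<open>lam - lam\<close>, which kills
  every coefficient from 2 on.\<close>

lemma deg_exp_self: "deg_exp lam lam = 1 + fps_const lam * fps_X"
proof (rule fps_ext)
  fix n
  have "deg_ff lam lam n = 0" if "n \<ge> 2"
    unfolding deg_ff_def using that by (intro prod_zero) (auto intro!: bexI[of _ 1])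
  then show "fps_nth (deg_exp lam lam) n = fps_nth (1 + fps_const lam * fps_X) n"
    by (cases "n = 0 \<or> n = 1") (auto simp: deg_exp_def deg_ff_def fps_X_def)
qed

text \<open>Splitting off the first factor \<open>x\<close> of the falling factorial leaves the one
  that starts at \<open>x - lam\<close>.\<close>

lemma fps_deriv_deg_exp:
  "fps_deriv (deg_exp lam x) = fps_const x * deg_exp lam (x - lam)"
proof (rule fps_ext)
  fix n
  have "deg_ff lam x (Suc n) = x * deg_ff lam (x - lam) n"
    unfolding deg_ff_def prod.lessThan_Suc_shift by (simp add: algebra_simps)
  then show "fps_nth (fps_deriv (deg_exp lam x)) n = fps_nth (fps_const x * deg_exp lam (x - lam)) n"
    by (simp add: deg_exp_def field_simps del: of_nat_Suc)
qed

lemma fps_deriv_deg_Fubini_gf: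
  "fps_deriv (deg_Fubini_gf lam t) = fps_const t * deg_exp lam (1 - lam) * deg_Fubini_gf lam t ^ 2"
  unfolding deg_Fubini_gf_def
  by (subst fps_inverse_deriv) (simp_all add: fps_deriv_deg_exp)

lemma deg_Stirling2_0_left: "deg_Stirling2 lam 0 k = (if k = 0 then 1 else 0)"
  by (simp add: deg_Stirling2_def fps_nth_power_0)

lemma deg_Stirling2_eq_0:
  assumes "n < k"
  shows "deg_Stirling2 lam n k = 0"
  using startsby_zero_power_prefix[of "deg_exp lam 1 - 1" k] assms
  by (simp add: deg_Stirling2_def)

lemma deg_Stirling2_Suc_0:
  "deg_Stirling2 lam (Suc n) 0 = 0"
  by (simp add: deg_Stirling2_def)

text \<open>With \<open>P k\<close> the generating function of column \<open>k\<close>, compare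
  coefficients in \<open>(1 + lam s) (P (k+1))' = P k + (k+1) P (k+1)\<close>.\<close>

lemma deg_Stirling2_Suc_Suc:
  assumes "lam \<noteq> 0"
  shows "deg_Stirling2 lam (Suc n) (Suc k) =
    deg_Stirling2 lam n k + (real (Suc k) - real n * lam) * deg_Stirling2 lam n (Suc k)"
proof -
  define P where "P k = fps_const (1 / fact k) * (deg_exp lam 1 - 1) ^ k" for k
  have S: "deg_Stirling2 lam n k = fact n * fps_nth (P k) n" for n k
    by (simp add: deg_Stirling2_def P_def)
  have c: "real (Suc k) * (1 / fact (Suc k)) = 1 / fact k"
    by (simp add: divide_simps del: of_nat_Suc)
  have P_Suc: "fps_const (real (Suc k)) * P (Suc k) = (deg_exp lam 1 - 1) * P k"
    unfolding P_def mult.assoc[symmetric] fps_const_mult c by (simp only: power_Suc mult_ac)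
  \<comment> \<open>The exponents \<open>lam\<close> and \<open>1 - lam\<close> add up to 1, so this
    multiplier clears the shifted exponential from the derivative.\<close>
  have e: "(1 + fps_const lam * fps_X) * deg_exp lam (1 - lam) = deg_exp lam 1"
    using deg_exp_add[OF assms, of lam "1 - lam"] by (simp add: deg_exp_self)
  have "fps_deriv (P (Suc k)) = P k * deg_exp lam (1 - lam)"
  proof -
    have "fps_deriv (P (Suc k)) = fps_const (1 / fact (Suc k)) *
        (fps_const (real (Suc k)) * deg_exp lam (1 - lam) * (deg_exp lam 1 - 1) ^ k)"
      by (simp add: P_def fps_deriv_power fps_deriv_deg_exp del: power_Suc fact_Suc of_nat_Suc)
    also have "\<dots> = fps_const (real (Suc k) * (1 / fact (Suc k))) *
        (deg_exp lam 1 - 1) ^ k * deg_exp lam (1 - lam)"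
      by (simp only: fps_const_mult[symmetric] mult_ac)
    finally show ?thesis
      by (simp only: c P_def)
  qed
  then have "(1 + fps_const lam * fps_X) * fps_deriv (P (Suc k)) = P k * deg_exp lam 1"
    by (simp add: e[symmetric] mult_ac)
  \<comment> \<open>Write the exponential as 1 plus \<open>deg_exp lam 1 - 1\<close>; the second
    part raises the column by \<open>P_Suc\<close>.\<close>
  also have "\<dots> = P k + fps_const (real (Suc k)) * P (Suc k)"
    by (simp only: P_Suc) (simp add: algebra_simps)
  finally have "fps_nth ((1 + fps_const lam * fps_X) * fps_deriv (P (Suc k))) n =
      fps_nth (P k + fps_const (real (Suc k)) * P (Suc k)) n"
    by simp
  \<comment> \<open>Multiplication by \<open>fps_X\<close> undoes the index shift of the derivative;
    for \<open>n = 0\<close> that term vanishes.\<close>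
  then have "real (Suc n) * fps_nth (P (Suc k)) (Suc n) + lam * (real n * fps_nth (P (Suc k)) n) =
      fps_nth (P k) n + real (Suc k) * fps_nth (P (Suc k)) n"
    by (cases n) (simp_all add: distrib_right mult.assoc)
  then have "real (Suc n) * fps_nth (P (Suc k)) (Suc n) =
      fps_nth (P k) n + (real (Suc k) - real n * lam) * fps_nth (P (Suc k)) n"
    by algebra
  then have "fact n * (real (Suc n) * fps_nth (P (Suc k)) (Suc n)) =
      fact n * (fps_nth (P k) n + (real (Suc k) - real n * lam) * fps_nth (P (Suc k)) n)"
    by (rule arg_cong)
  then show ?thesis
    by (simp add: S algebra_simps)
qed

text \<open>On coefficients scaled by factorials, differentiation is the index shift; this is how
  \<open>n + m\<close> enters the theorem.\<close>

lemma fps_nth_fps_nth_deriv: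
  fixes f :: "'a :: {comm_semiring_1, semiring_char_0} fps"
  shows "fact n * fps_nth (fps_nth_deriv m f) n = fact (n + m) * fps_nth f (n + m)"
  by (induction m arbitrary: f) (simp_all add: algebra_simps)

lemma fps_nth_deriv_deg_Fubini_gf:
  assumes "lam \<noteq> 0"
  shows "fps_nth_deriv m (deg_Fubini_gf lam t) =
    (\<Sum>k=0..m. fps_const (fact k * deg_Stirling2 lam m k * t ^ k) *
      (deg_Fubini_gf lam t ^ Suc k * deg_exp lam (real k - real m * lam)))"
proof (induction m)
  case 0
  have "deg_exp lam 0 = 1"
    using fps_deriv_deg_exp[of lam 0] by (simp add: fps_deriv_eq_0_iff)
  then show ?case
    by (simp add: deg_Stirling2_0_left)
next
  case (Suc m)
  let ?G = "deg_Fubini_gf lam t"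
  \<comment> \<open>\<open>B\<close> already has the exponent for \<open>Suc m\<close>:
    differentiating the \<open>k\<close>-th term yields only \<open>B k\<close> and
    \<open>B (Suc k)\<close>.\<close>
  define B where "B k = ?G ^ Suc k * deg_exp lam (real k - real (Suc m) * lam)" for k
  define c where "c k = fact k * deg_Stirling2 lam m k * t ^ k" for k
  have deriv: "fps_deriv (?G ^ Suc k * deg_exp lam (real k - real m * lam)) =
      fps_const (real (Suc k) * t) * B (Suc k) + fps_const (real k - real m * lam) * B k" for k
  proof -
    have "deg_exp lam (real (Suc k) - real (Suc m) * lam) =
        deg_exp lam (1 - lam) * deg_exp lam (real k - real m * lam)"
      by (subst deg_exp_add[OF assms, symmetric]) (simp add: algebra_simps)
    moreover have "fps_deriv (deg_exp lam (real k - real m * lam)) =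
        fps_const (real k - real m * lam) * deg_exp lam (real k - real (Suc m) * lam)"
      by (simp add: fps_deriv_deg_exp algebra_simps)
    moreover have "fps_deriv (?G ^ Suc k) =
        fps_const (real (Suc k) * t) * deg_exp lam (1 - lam) * ?G ^ Suc (Suc k)"
      unfolding fps_deriv_power fps_deriv_deg_Fubini_gf
      by (simp add: power2_eq_square fps_of_nat[symmetric] fps_const_mult[symmetric] mult_ac
          del: fps_const_mult of_nat_Suc)
    ultimately show ?thesis
      by (simp only: B_def fps_deriv_mult mult_ac add_ac)
  qed
  \<comment> \<open>The recursion of \<open>fps_nth_deriv\<close> differentiates innermost first;
    the induction needs the new derivative outermost.\<close>
  have "fps_nth_deriv (Suc m) ?G = fps_deriv (fps_nth_deriv m ?G)"
    by (metis fps_nth_deriv_commute fps_nth_deriv.simps(2))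
  also have "\<dots> = (\<Sum>k=0..m. fps_const (c k) *
      (fps_const (real (Suc k) * t) * B (Suc k) + fps_const (real k - real m * lam) * B k))"
    unfolding Suc.IH fps_deriv_sum
    by (intro sum.cong refl) (simp only: fps_deriv_mult_const_left deriv c_def)
  also have "\<dots> = (\<Sum>k=0..m. fps_const (real (Suc k) * t * c k) * B (Suc k)) +
      (\<Sum>k=0..m. fps_const ((real k - real m * lam) * c k) * B k)"
    unfolding sum.distrib[symmetric]
    by (intro sum.cong refl)
       (simp only: distrib_left fps_const_mult[symmetric] mult.assoc mult.left_commute[of "fps_const (c _)"])
  \<comment> \<open>The added term \<open>k = Suc m\<close> is zero; it lets the sum be reindexed by
    \<open>Suc k\<close> to match the other one.\<close>
  also have "(\<Sum>k=0..m. fps_const ((real k - real m * lam) * c k) * B k) =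
      (\<Sum>k=0..Suc m. fps_const ((real k - real m * lam) * c k) * B k)"
    by (simp add: c_def deg_Stirling2_eq_0)
  also have "\<dots> = (\<Sum>k=0..m. fps_const ((real (Suc k) - real m * lam) * c (Suc k)) * B (Suc k))"
  proof -
    \<comment> \<open>For \<open>m = 0\<close> the first factor vanishes, for \<open>m > 0\<close>
      the Stirling number in \<open>c 0\<close>.\<close>
    have "(0 - real m * lam) * c 0 = 0"
      by (cases m) (simp_all add: c_def deg_Stirling2_Suc_0)
    then show ?thesis
      by (subst sum.atLeast0_atMost_Suc_shift) (simp del: of_nat_Suc)
  qed
  also have "(\<Sum>k=0..m. fps_const (real (Suc k) * t * c k) * B (Suc k)) + \<dots> =
      (\<Sum>k=0..m. fps_const (fact (Suc k) * deg_Stirling2 lam (Suc m) (Suc k) * t ^ Suc k) *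
        B (Suc k))"
  proof -
    have "fact (Suc k) * deg_Stirling2 lam (Suc m) (Suc k) * t ^ Suc k =
        real (Suc k) * t * c k + (real (Suc k) - real m * lam) * c (Suc k)" for k
      unfolding deg_Stirling2_Suc_Suc[OF assms] c_def by (simp add: algebra_simps)
    then show ?thesis
      by (simp only: fps_const_add[symmetric] distrib_right sum.distrib)
  qed
  also have "\<dots> = (\<Sum>k=0..Suc m. fps_const (fact k * deg_Stirling2 lam (Suc m) k * t ^ k) * B k)"
    by (subst sum.atLeast0_atMost_Suc_shift) (simp add: deg_Stirling2_Suc_0)
  finally show ?case
    unfolding B_def .
qed

theorem theorem3:
  fixes lam t :: real and m n :: nat
  assumes "lam \<noteq> 0"
  shows "deg_Fubini lam (n + m) t =
    (\<Sum>k=0..m. \<Sum>l=0..n.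
      fact k * deg_Stirling2 lam m k * real (n choose l) * t ^ k
        * deg_Fubini2 lam (real k) (n - l) t (real k - real m * lam) * deg_Fubini lam l t)"
proof -
  let ?G = "deg_Fubini_gf lam t"
  \<comment> \<open>One factor of \<open>?G ^ Suc k\<close> is set aside to produce
    \<open>deg_Fubini lam l t\<close>; the remaining \<open>k\<close> form the order of
    \<open>deg_Fubini2\<close>, and the Cauchy product gives the sum over \<open>l\<close>.\<close>
  define H where "H k = ?G ^ k * deg_exp lam (real k - real m * lam)" for k
  have H: "fps_nth (H k) j = deg_Fubini2 lam (real k) j t (real k - real m * lam) / fact j" for k j
    by (simp add: H_def deg_Fubini2_def fps_rpow_of_nat)
  have coeff: "fact n * fps_nth (?G * H k) n = (\<Sum>l=0..n. real (n choose l) *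
      deg_Fubini2 lam (real k) (n - l) t (real k - real m * lam) * deg_Fubini lam l t)" for k
    unfolding fps_mult_nth sum_distrib_left
    by (intro sum.cong refl) (simp add: H deg_Fubini_gf_nth binomial_fact)
  have "deg_Fubini lam (n + m) t = fact n * fps_nth (fps_nth_deriv m ?G) n"
    by (simp add: fps_nth_fps_nth_deriv deg_Fubini_gf_nth)
  also have "\<dots> = (\<Sum>k=0..m. fact k * deg_Stirling2 lam m k * t ^ k * (fact n * fps_nth (?G * H k) n))"
    unfolding fps_nth_deriv_deg_Fubini_gf[OF assms] fps_sum_nth sum_distrib_left
    by (intro sum.cong refl) (simp add: fps_mult_left_const_nth H_def mult.assoc mult.left_commute[of "fact n"])
  also have "\<dots> = (\<Sum>k=0..m. \<Sum>l=0..n.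
      fact k * deg_Stirling2 lam m k * real (n choose l) * t ^ k
        * deg_Fubini2 lam (real k) (n - l) t (real k - real m * lam) * deg_Fubini lam l t)"
    unfolding coeff sum_distrib_left by (intro sum.cong refl) (simp add: mult_ac)
  finally show ?thesis .
qed

end
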